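(* Let $n$, $c$, $k$ and $r$ be integers such that $n = ck + r$, $c \geq 2$, $k \geq 3$ and $r \in \{1, 2, \ldots, k-1\}$. Suppose that $n=hm$ for positive integers $m$ and $h$ such that $m \equiv 0 \pmod{c}$ and let \[p_1 = \left\lfloor\frac{m(h^c-c-1)}{c(k-r)}\right\rfloor, \quad p_2 = \left\lfloor\frac{ m}{r}\left\lfloor\frac{\binom{h}{c+1}}{\binom{m-1}{c-1}}\right\rfloor\right\rfloor, \quad p'_1 = \left\lfloor\frac{mh^c}{c(k-r)}\right\rfloor, \quad p'_2 = \left\lfloor\frac{ m\binom{h}{c+1}}{r\binom{m-1}{c-1}}\right\rfloor.\] There exists an almost uniform $(n,k)$-Sperner partition system with $p\binom{m-1}{c-1}$ partitions if (a) $p=\min\{p_1,p_2\}$; or (b) $p=\min\{p'_1,p'_2\}$ and $pr \equiv 0 \pmod{m}$.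
   Context: For integers $n \geq k \geq 1$, an $(n,k)$-Sperner partition system is a set of partitions of some $n$-set such that each partition has exactly $k$ nonempty parts and no part in any partition is a subset of a part in a different partition. It is called almost uniform if each part of each partition in the system has size $\lfloor \frac{n}{k}\rfloor$ or $\lceil \frac{n}{k}\rceil$. *)

theory Defs
  imports Complex_Main "HOL-Library.Disjoint_Sets"
begin

text \<open>
  Nonemptiness of the parts is part of \<open>partition_on\<close>.
\<close>

definition sperner_partition_system :: "nat \<Rightarrow> nat \<Rightarrow> 'a set \<Rightarrow> 'a set set set \<Rightarrow> bool" where
  "sperner_partition_system n k X S \<longleftrightarrow>
     n \<ge> k \<and> k \<ge> 1 \<and> finite X \<and> card X = n \<and>
     (\<forall>P\<in>S. partition_on X P \<and> card P = k) \<and>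
     (\<forall>P\<in>S. \<forall>Q\<in>S. P \<noteq> Q \<longrightarrow> (\<forall>A\<in>P. \<forall>B\<in>Q. \<not> A \<subseteq> B))"

definition almost_uniform :: "nat \<Rightarrow> nat \<Rightarrow> 'a set set set \<Rightarrow> bool" where
  "almost_uniform n k S \<longleftrightarrow>
     (\<forall>P\<in>S. \<forall>A\<in>P. int (card A) = \<lfloor>real n / real k\<rfloor> \<or> int (card A) = \<lceil>real n / real k\<rceil>)"

end

theory Submission imports Defs "HOL-Library.Multiset" begin

text \<open>
  Split the \<open>n = h * m\<close> points into \<open>m\<close> groups of size \<open>h\<close>. The parts of size \<open>c\<close> meet \<open>c\<close>
  different groups in one point each, the parts of size \<open>c + 1\<close> lie inside one group; hence no part
  contains another one as soon as all parts are distinct. By a detachment theorem in the style of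
  Baranyai and Bryant it suffices to prescribe, for each partition, the types of its parts, i.e. how
  many points they have in each group, so that every group is covered \<open>h\<close> times by each partition
  and no type is used more often than there are sets of that type.

  Since \<open>c\<close> divides \<open>m\<close>, it divides \<open>r\<close>, and Baranyai's theorem splits the \<open>c\<close>-sets of groups into
  \<open>(m - 1) choose (c - 1)\<close> parallel classes. Each class serves \<open>p\<close> partitions, in which the \<open>r\<close> parts
  of size \<open>c + 1\<close> are spread evenly over the \<open>m / c\<close> blocks of the class, and equally over the groups
  of a block; the rest of a block is covered by parts of size \<open>c\<close> transversal to its groups.
\<close>

section \<open>Integral flows with quotas, by augmenting paths\<close>

section \<open>Integral assignments\<close>

text \<open>Cutting a walk at its last visit to \<open>a\<close> leaves one step followed by a walk
  avoiding \<open>a\<close>. In \<open>augment\<close> this protects the rest of the path from the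
  first reassignment.\<close>

lemma rtrancl_avoid_start:
  assumes "(a, b) \<in> r\<^sup>*" "a \<noteq> b"
  shows "\<exists>c. (a, c) \<in> r \<and> c \<noteq> a \<and> (c, b) \<in> (r \<inter> (- {a}) \<times> (- {a}))\<^sup>*"
  using assms
proof (induction rule: rtrancl_induct)
  case base
  then show ?case by simp
next
  case (step y z)
  show ?case
  proof (cases "a = y")
    case True
    then show ?thesis using step by blast
  next
    case False
    then obtain c where c: "(a, c) \<in> r" "c \<noteq> a" "(c, y) \<in> (r \<inter> (- {a}) \<times> (- {a}))\<^sup>*"
      using step by blast
    have "(y, z) \<in> r \<inter> (- {a}) \<times> (- {a})" using step False by auto
    then show ?thesis using c by (meson rtrancl.rtrancl_into_rtrancl)
  qed
qed

definition load :: "'l set \<Rightarrow> ('l \<Rightarrow> 't) \<Rightarrow> 't \<Rightarrow> nat" where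
  "load L f t = card {l \<in> L. f l = t}"

definition admissible :: "'l set \<Rightarrow> 't set \<Rightarrow> ('l \<Rightarrow> 't \<Rightarrow> nat) \<Rightarrow> ('l \<Rightarrow> 't) \<Rightarrow> bool" where
  "admissible L T w f \<longleftrightarrow> (\<forall>l\<in>L. f l \<in> T \<and> w l (f l) > 0)"

text \<open>The residual graph of the assignment: an edge means that some label on \<open>t\<close>
  may be shifted to \<open>t'\<close>.\<close>

definition moves :: "'l set \<Rightarrow> 't set \<Rightarrow> ('l \<Rightarrow> 't \<Rightarrow> nat) \<Rightarrow> ('l \<Rightarrow> 't) \<Rightarrow> ('t \<times> 't) set" where
  "moves L T w f = {(t, t'). t' \<in> T \<and> (\<exists>l\<in>L. f l = t \<and> w l t' > 0)}"

lemma load_fun_upd: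
  assumes "finite L" "l \<in> L" "f l = a" "b \<noteq> a"
  shows "load L (f(l := b)) a + 1 = load L f a"
    and "load L (f(l := b)) b = load L f b + 1"
    and "t \<noteq> a \<Longrightarrow> t \<noteq> b \<Longrightarrow> load L (f(l := b)) t = load L f t"
proof -
  have "{x \<in> L. f x = a} = insert l {x \<in> L. (f(l := b)) x = a}" using assms by auto
  then show "load L (f(l := b)) a + 1 = load L f a"
    using assms by (simp add: load_def)
  have "{x \<in> L. (f(l := b)) x = b} = insert l {x \<in> L. f x = b}" using assms by auto
  then show "load L (f(l := b)) b = load L f b + 1"
    using assms by (simp add: load_def)
  show "load L (f(l := b)) t = load L f t" if "t \<noteq> a" "t \<noteq> b"
    using that assms unfolding load_def by (intro arg_cong[of _ _ card]) auto
qed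

text \<open>Along a path of moves one label is shifted over each edge; intermediate targets lose one
  label and gain one. The set \<open>A\<close> confines the path, and deleting the start
  \<open>a\<close> from it drives the induction.\<close>

lemma augment:
  assumes "finite L" "finite A"
    and "admissible L T w f" "(a, b) \<in> (moves L T w f \<inter> A \<times> A)\<^sup>*" "a \<noteq> b"
  shows "\<exists>f'. admissible L T w f' \<and> load L f' a + 1 = load L f a \<and> load L f' b = load L f b + 1
    \<and> (\<forall>t. t \<noteq> a \<longrightarrow> t \<noteq> b \<longrightarrow> load L f' t = load L f t)"
  using assms(2-)
proof (induction A arbitrary: f a rule: finite_psubset_induct)
  case (psubset A)
  from rtrancl_avoid_start[OF psubset.prems(2,3)] obtain c where
    c: "(a, c) \<in> moves L T w f" "a \<in> A" "c \<noteq> a"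
      "(c, b) \<in> (moves L T w f \<inter> A \<times> A \<inter> (- {a}) \<times> (- {a}))\<^sup>*" by blast
  then obtain l where l: "l \<in> L" "f l = a" "w l c > 0" "c \<in> T" by (auto simp: moves_def)
  let ?f = "f(l := c)"
  have adm: "admissible L T w ?f"
    using psubset.prems(1) l by (auto simp: admissible_def)
  note ld = load_fun_upd[where f = f, OF assms(1) l(1,2) c(3)]
  show ?case
  proof (cases "c = b")
    case True
    then show ?thesis using adm ld by blast
  next
    case False
    \<comment> \<open>Only \<open>l\<close> is reassigned, and it sat on \<open>a\<close>, so moves
      that avoid \<open>a\<close> survive.\<close>
    have "moves L T w f \<inter> A \<times> A \<inter> (- {a}) \<times> (- {a}) \<subseteq> moves L T w ?f \<inter> (A - {a}) \<times> (A - {a})"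
      using l by (fastforce simp: moves_def)
    then have "(c, b) \<in> (moves L T w ?f \<inter> (A - {a}) \<times> (A - {a}))\<^sup>*"
      using c(4) rtrancl_mono by blast
    moreover have "A - {a} \<subset> A" using c by auto
    ultimately obtain f' where f': "admissible L T w f'" "load L f' c + 1 = load L ?f c"
      "load L f' b = load L ?f b + 1" "\<forall>t. t \<noteq> c \<longrightarrow> t \<noteq> b \<longrightarrow> load L f' t = load L ?f t"
      using psubset.IH adm False by blast
    have "load L f' t = load L f t" if "t \<noteq> a" "t \<noteq> b" for t
      using f' ld that by (cases "t = c") auto
    moreover have "load L f' a + 1 = load L f a" "load L f' b = load L f b + 1"
      using f' ld psubset.prems(3) c(3) False by auto
    ultimately show ?thesis using f'(1) by blast
  qed
qed

lemma sum_load: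
  assumes "finite L" "finite R"
  shows "(\<Sum>t\<in>R. load L f t) = card {l \<in> L. f l \<in> R}"
proof -
  have "card {l \<in> L. f l \<in> R} = card (\<Union>t\<in>R. {l \<in> L. f l = t})"
    by (rule arg_cong[of _ _ card]) auto
  also have "\<dots> = (\<Sum>t\<in>R. card {l \<in> L. f l = t})"
    using assms by (intro card_UN_disjoint) auto
  finally show ?thesis by (simp add: load_def)
qed

text \<open>Integrality of bipartite flows: dividing \<open>w\<close> by \<open>s\<close> gives a fractional assignment
  respecting the quotas. An assignment minimising the total quota violation respects them too,
  since the targets reachable from a violated one would otherwise carry the wrong total load.\<close>

lemma integral_assignment:
  fixes w :: "'l \<Rightarrow> 't \<Rightarrow> nat"
  assumes fin: "finite L" "finite T" and s: "s > 0"
    and row: "\<And>l. l \<in> L \<Longrightarrow> (\<Sum>t\<in>T. w l t) = s"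
    and lo: "\<And>t. t \<in> T \<Longrightarrow> s * lo t \<le> (\<Sum>l\<in>L. w l t)"
    and hi: "\<And>t. t \<in> T \<Longrightarrow> (\<Sum>l\<in>L. w l t) \<le> s * hi t"
  shows "\<exists>f. admissible L T w f \<and> (\<forall>t\<in>T. lo t \<le> load L f t \<and> load L f t \<le> hi t)"
proof -
  \<comment> \<open>With truncated subtraction each summand is the distance of the load from its
    quota interval.\<close>
  define viol where "viol f = (\<Sum>t\<in>T. (load L f t - hi t) + (lo t - load L f t))" for f
  have "\<exists>t. t \<in> T \<and> w l t > 0" if "l \<in> L" for l
    using row[OF that] s by (metis not_gr_zero sum.neutral)
  then have "\<exists>f. admissible L T w f" unfolding admissible_def by metis
  then obtain f where f: "admissible L T w f" and min: "\<And>f'. admissible L T w f' \<Longrightarrow> viol f \<le> viol f'"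
    using ex_has_least_nat[of "admissible L T w" _ viol] by metis
  have lohi: "lo t \<le> hi t" if "t \<in> T" for t
    using lo[OF that] hi[OF that] s by (meson le_trans mult_le_cancel1)
  have reach_T: "b \<in> T" if "(a, b) \<in> (moves L T w f)\<^sup>*" "a \<in> T" for a b
    using that by (induction rule: rtrancl_induct) (auto simp: moves_def)
  \<comment> \<open>At a minimum of \<open>viol\<close> no path can lead from a target with a label
    to spare to one with room if either of them violates its quota.\<close>
  have improve: False
    if ab: "(a, b) \<in> (moves L T w f)\<^sup>*" "a \<in> T" "load L f a > lo a" "load L f b < hi b"
      "load L f a > hi a \<or> load L f b < lo b" for a b
  proof -
    have b: "b \<in> T" using reach_T ab by blast
    have ne: "a \<noteq> b" using ab lohi[OF b] by auto
    have "moves L T w f \<subseteq> T \<times> T" using f by (auto simp: moves_def admissible_def)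
    then have "moves L T w f \<inter> T \<times> T = moves L T w f" by blast
    then obtain f' where f': "admissible L T w f'" "load L f' a + 1 = load L f a"
      "load L f' b = load L f b + 1" "\<forall>t. t \<noteq> a \<longrightarrow> t \<noteq> b \<longrightarrow> load L f' t = load L f t"
      using augment[OF fin f, of a b] ab ne by auto
    define d where "d g t = (load L g t - hi t) + (lo t - load L g t)" for g t
    have le: "d f' t \<le> d f t" if "t \<in> T" for t
    proof -
      consider "t = a" | "t = b" | "t \<noteq> a" "t \<noteq> b" by blast
      then show ?thesis
      proof cases
        case 1
        then show ?thesis using f'(2) ab by (simp add: d_def)
      next
        case 2
        then show ?thesis using f'(3) ab by (simp add: d_def)
      next
        case 3
        then show ?thesis using f'(4) by (simp add: d_def)
      qed
    qed
    have "d f' a < d f a \<or> d f' b < d f b"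
      using f'(2,3) ab lohi[OF ab(2)] lohi[OF b] by (auto simp: d_def)
    then have "(\<Sum>t\<in>T. d f' t) < (\<Sum>t\<in>T. d f t)"
      using fin(2) le b ab(2) by (intro sum_strict_mono_ex1) auto
    then show False using min[OF f'(1)] by (simp add: viol_def d_def)
  qed
  \<comment> \<open>If no label on \<open>R\<close> can leave \<open>R\<close>, all weight of those
    labels lies in the columns of \<open>R\<close>.\<close>
  have count_le: "s * card {l \<in> L. f l \<in> R} \<le> (\<Sum>t\<in>R. \<Sum>l\<in>L. w l t)"
    if R: "R \<subseteq> T" and closed: "\<And>l t. l \<in> L \<Longrightarrow> f l \<in> R \<Longrightarrow> t \<in> T \<Longrightarrow> w l t > 0 \<Longrightarrow> t \<in> R" for R
  proof -
    have "s * card {l \<in> L. f l \<in> R} = (\<Sum>l\<in>{l \<in> L. f l \<in> R}. \<Sum>t\<in>T. w l t)"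
      using row by simp
    also have "\<dots> = (\<Sum>l\<in>{l \<in> L. f l \<in> R}. \<Sum>t\<in>R. w l t)"
      using R closed fin by (intro sum.cong sum.mono_neutral_right) auto
    also have "\<dots> \<le> (\<Sum>l\<in>L. \<Sum>t\<in>R. w l t)" using fin by (intro sum_mono2) auto
    finally show ?thesis by (subst sum.swap)
  qed
  \<comment> \<open>Dually, if only labels on \<open>R\<close> have weight in \<open>R\<close>, the
    columns of \<open>R\<close> draw on those rows alone.\<close>
  have count_ge: "(\<Sum>t\<in>R. \<Sum>l\<in>L. w l t) \<le> s * card {l \<in> L. f l \<in> R}"
    if R: "R \<subseteq> T" and closed: "\<And>l t. l \<in> L \<Longrightarrow> t \<in> R \<Longrightarrow> w l t > 0 \<Longrightarrow> f l \<in> R" for R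
  proof -
    have "(\<Sum>t\<in>R. \<Sum>l\<in>L. w l t) = (\<Sum>l\<in>L. \<Sum>t\<in>R. w l t)" by (rule sum.swap)
    also have "\<dots> = (\<Sum>l\<in>{l \<in> L. f l \<in> R}. \<Sum>t\<in>R. w l t)"
      using fin by (intro sum.mono_neutral_right) (auto intro!: sum.neutral dest: closed)
    also have "\<dots> \<le> (\<Sum>l\<in>{l \<in> L. f l \<in> R}. \<Sum>t\<in>T. w l t)"
      using R fin by (intro sum_mono sum_mono2) auto
    also have "\<dots> = s * card {l \<in> L. f l \<in> R}" using row by simp
    finally show ?thesis .
  qed
  have "load L f a \<le> hi a" if a: "a \<in> T" for a
  proof (rule ccontr)
    assume ex: "\<not> load L f a \<le> hi a"
    \<comment> \<open>By \<open>improve\<close> everything reachable from the overloaded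
      \<open>a\<close> is full, so the closed set \<open>R\<close> carries more than its upper
      quotas allow.\<close>
    define R where "R = {b. (a, b) \<in> (moves L T w f)\<^sup>*}"
    have RT: "R \<subseteq> T" "finite R" using reach_T a fin by (auto simp: R_def intro: finite_subset)
    have "hi t \<le> load L f t" if "t \<in> R" for t
      using improve[of a t] that a ex lohi[OF a] by (auto simp: R_def intro: leI)
    then have "(\<Sum>t\<in>R. hi t) < (\<Sum>t\<in>R. load L f t)"
      using RT ex by (intro sum_strict_mono_ex1) (auto simp: R_def)
    then have "s * (\<Sum>t\<in>R. hi t) < s * card {l \<in> L. f l \<in> R}"
      using s fin RT by (simp add: sum_load)
    also have "\<dots> \<le> (\<Sum>t\<in>R. \<Sum>l\<in>L. w l t)"
    proof (rule count_le[OF RT(1)])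
      fix l t assume "l \<in> L" "f l \<in> R" "t \<in> T" "w l t > 0"
      then have "(f l, t) \<in> moves L T w f" by (auto simp: moves_def)
      then show "t \<in> R" using \<open>f l \<in> R\<close> by (auto simp: R_def intro: rtrancl_into_rtrancl)
    qed
    also have "\<dots> \<le> (\<Sum>t\<in>R. s * hi t)" using hi RT by (intro sum_mono) auto
    finally show False by (simp add: sum_distrib_left)
  qed
  moreover have "lo b \<le> load L f b" if b: "b \<in> T" for b
  proof (rule ccontr)
    assume ex: "\<not> lo b \<le> load L f b"
    \<comment> \<open>The mirror image: targets that can reach the deficient \<open>b\<close> have
      nothing to spare.\<close>
    define R where "R = {a \<in> T. (a, b) \<in> (moves L T w f)\<^sup>*}"
    have RT: "R \<subseteq> T" "finite R" using fin by (auto simp: R_def intro: finite_subset)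
    have "load L f t \<le> lo t" if "t \<in> R" for t
      using improve[of t b] that ex lohi[OF b] by (auto simp: R_def intro: leI)
    then have "(\<Sum>t\<in>R. load L f t) < (\<Sum>t\<in>R. lo t)"
      using RT ex b by (intro sum_strict_mono_ex1) (auto simp: R_def)
    then have "s * card {l \<in> L. f l \<in> R} < s * (\<Sum>t\<in>R. lo t)"
      using s fin RT by (simp add: sum_load)
    also have "\<dots> \<le> (\<Sum>t\<in>R. \<Sum>l\<in>L. w l t)"
      unfolding sum_distrib_left using lo RT by (intro sum_mono) auto
    also have "\<dots> \<le> s * card {l \<in> L. f l \<in> R}"
    proof (rule count_ge[OF RT(1)])
      fix l t assume *: "l \<in> L" "t \<in> R" "w l t > 0"
      then have "(f l, t) \<in> moves L T w f" using RT by (auto simp: moves_def)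
      then show "f l \<in> R"
        using * f by (auto simp: R_def admissible_def intro: converse_rtrancl_into_rtrancl)
    qed
    finally show False by simp
  qed
  ultimately show ?thesis using f by blast
qed

section \<open>Baranyai's method for points in prescribed groups\<close>

section \<open>Detachment\<close>

text \<open>The number of point sets of type \<open>t\<close> when group \<open>b\<close> consists
  of \<open>u b\<close> points.\<close>

definition num_of_type :: "'b set \<Rightarrow> ('b \<Rightarrow> nat) \<Rightarrow> 'b multiset \<Rightarrow> nat" where
  "num_of_type I u t = (\<Prod>b\<in>I. u b choose count t b)"

lemma num_of_type_remove:
  assumes "finite I" "b \<in> I"
  shows "num_of_type I u t = (u b choose count t b) * num_of_type (I - {b}) u t"
  using assms by (simp add: num_of_type_def prod.remove)

lemma num_of_type_cong:
  "(\<And>b. b \<in> I \<Longrightarrow> u b = u' b \<and> count t b = count t' b) \<Longrightarrow> num_of_type I u t = num_of_type I u' t'"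
  by (simp add: num_of_type_def)

text \<open>Double counting of pairs of a set of type \<open>t\<close> and a point of group
  \<open>b\<close> outside it.\<close>

lemma num_of_type_without:
  assumes "finite I" "b \<in> I"
  shows "u b * num_of_type I (u(b := u b - 1)) t = (u b - count t b) * num_of_type I u t"
proof -
  have *: "n * ((n - 1) choose k) = (n - k) * (n choose k)" for n k :: nat
  proof (cases "k \<le> n")
    case False
    then show ?thesis by (cases n) auto
  qed (simp add: binomial_absorb_comp)
  have "num_of_type (I - {b}) (u(b := u b - 1)) t = num_of_type (I - {b}) u t"
    by (intro num_of_type_cong) auto
  then show ?thesis
    using *[of "u b" "count t b"] by (simp add: num_of_type_remove[OF assms] flip: mult.assoc)
qed

text \<open>Double counting of pairs of a set and one of its points in group \<open>b\<close>;
  without that point the set has type \<open>t\<close>.\<close>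

lemma num_of_type_with:
  assumes "finite I" "b \<in> I"
  shows "u b * num_of_type I (u(b := u b - 1)) t = (count t b + 1) * num_of_type I u (add_mset b t)"
proof -
  have *: "n * ((n - 1) choose k) = (k + 1) * (n choose (k + 1))" for n k :: nat
    using binomial_absorption[of k n] by simp
  have "num_of_type (I - {b}) (u(b := u b - 1)) t = num_of_type (I - {b}) u (add_mset b t)"
    by (intro num_of_type_cong) auto
  then show ?thesis
    using *[of "u b" "count t b"] by (simp add: num_of_type_remove[OF assms] flip: mult.assoc)
qed

text \<open>The invariant, with \<open>Y\<close> the points already distributed. Its first clause is
  global over \<open>L\<close>: a key occurs at most as often as it can be completed by
  undistributed points. Keys form a multiset because unfinished parts may still look alike.\<close>

definition detached ::
  "'l set \<Rightarrow> 'a set \<Rightarrow> ('a \<Rightarrow> 'b) \<Rightarrow> ('l \<Rightarrow> 'b multiset multiset) \<Rightarrow> 'a set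
    \<Rightarrow> ('l \<Rightarrow> ('a set \<times> 'b multiset) multiset) \<Rightarrow> bool" where
  "detached L X g M Y D \<longleftrightarrow>
    (\<forall>T t. (\<Sum>l\<in>L. count (D l) (T, t)) \<le> num_of_type (g ` X) (\<lambda>b. card {x \<in> X - Y. g x = b}) t) \<and>
    (\<forall>l\<in>L. (\<forall>\<kappa>\<in>#D l. fst \<kappa> \<subseteq> Y) \<and>
      (\<forall>b. (\<Sum>\<kappa>\<in>#D l. count (snd \<kappa>) b) = card {x \<in> X - Y. g x = b}) \<and>
      (\<forall>y\<in>Y. size {#\<kappa> \<in># D l. y \<in> fst \<kappa>#} = 1) \<and>
      image_mset (\<lambda>\<kappa>. image_mset g (mset_set (fst \<kappa>)) + snd \<kappa>) (D l) = M l)"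

lemma sum_mset_count_weighted:
  assumes "finite A" "set_mset N \<subseteq> A"
  shows "(\<Sum>x\<in>#N. f x) = (\<Sum>x\<in>A. count N x * (f x :: nat))"
  using assms(2)
proof (induction N)
  case (add a N)
  have "(\<Sum>x\<in>A. count (add_mset a N) x * f x) = (\<Sum>x\<in>A. (if x = a then f x else 0) + count N x * f x)"
    by (intro sum.cong) auto
  then show ?case using add assms(1) by (simp add: sum.distrib)
qed simp

lemma detach_point:
  fixes g :: "'a \<Rightarrow> 'b"
  assumes fin: "finite L" "finite X" and v: "v \<in> X" "v \<notin> Y" "Y \<subseteq> X"
    and det: "detached L X g M Y D"
  shows "\<exists>D'. detached L X g M (insert v Y) D'"
proof -
  define b where "b = g v"
  define I where "I = g ` X"
  define u where "u = (\<lambda>b. card {x \<in> X - Y. g x = b})"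
  define u' where "u' = (\<lambda>b. card {x \<in> X - insert v Y. g x = b})"
  define K where "K = num_of_type I u"
  define K' where "K' = num_of_type I u'"
  have I: "finite I" "b \<in> I" using fin v by (auto simp: I_def b_def)
  have "{x \<in> X - Y. g x = b} = insert v {x \<in> X - insert v Y. g x = b}" using v by (auto simp: b_def)
  then have ub: "u b = u' b + 1" using fin by (simp add: u_def u'_def)
  have u': "u' = u(b := u b - 1)"
  proof
    fix i show "u' i = (u(b := u b - 1)) i"
    proof (cases "i = b")
      case False
      then have "{x \<in> X - insert v Y. g x = i} = {x \<in> X - Y. g x = i}" by (auto simp: b_def)
      then show ?thesis using False by (simp add: u_def u'_def)
    qed (simp add: ub)
  qed
  have D: "\<And>T t. (\<Sum>l\<in>L. count (D l) (T, t)) \<le> K t"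
    "\<And>l \<kappa>. l \<in> L \<Longrightarrow> \<kappa> \<in># D l \<Longrightarrow> fst \<kappa> \<subseteq> Y"
    "\<And>l i. l \<in> L \<Longrightarrow> (\<Sum>\<kappa>\<in>#D l. count (snd \<kappa>) i) = u i"
    "\<And>l y. l \<in> L \<Longrightarrow> y \<in> Y \<Longrightarrow> size {#\<kappa> \<in># D l. y \<in> fst \<kappa>#} = 1"
    "\<And>l. l \<in> L \<Longrightarrow> image_mset (\<lambda>\<kappa>. image_mset g (mset_set (fst \<kappa>)) + snd \<kappa>) (D l) = M l"
    using det by (auto simp: detached_def K_def I_def u_def)
  define S where "S = (\<Union>l\<in>L. set_mset (D l))"
  have finS: "finite S" using fin by (simp add: S_def)
  \<comment> \<open>\<open>w l \<kappa> / u b\<close> is the expected number of copies of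
    \<open>\<kappa>\<close> in \<open>D l\<close> that receive \<open>v\<close>.\<close>
  define w where "w = (\<lambda>l \<kappa>. count (D l) \<kappa> * count (snd \<kappa>) b)"
  \<comment> \<open>Copies of \<open>(T, t)\<close> that take \<open>v\<close> become
    \<open>(insert v T, t - {#b#})\<close>, which limits them to \<open>hi\<close>. The others
    remain \<open>(T, t)\<close> and must not exceed \<open>K' t\<close>, so at least
    \<open>lo\<close> copies take \<open>v\<close>.\<close>
  define hi where "hi = (\<lambda>\<kappa> :: 'a set \<times> 'b multiset. K' (snd \<kappa> - {#b#}))"
  define lo where "lo = (\<lambda>\<kappa>. (\<Sum>l\<in>L. count (D l) \<kappa>) - K' (snd \<kappa>))"
  have sum_w: "(\<Sum>l\<in>L. w l \<kappa>) = (\<Sum>l\<in>L. count (D l) \<kappa>) * count (snd \<kappa>) b" for \<kappa>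
    by (simp add: w_def sum_distrib_right)
  have "\<exists>f. admissible L S w f \<and> (\<forall>\<kappa>\<in>S. lo \<kappa> \<le> load L f \<kappa> \<and> load L f \<kappa> \<le> hi \<kappa>)"
  proof (rule integral_assignment[where s = "u b"])
    fix l assume l: "l \<in> L"
    have "set_mset (D l) \<subseteq> S" using l by (auto simp: S_def)
    then show "(\<Sum>\<kappa>\<in>S. w l \<kappa>) = u b"
      using D(3)[OF l, of b] finS by (simp add: w_def sum_mset_count_weighted)
  next
    fix \<kappa> assume "\<kappa> \<in> S"
    obtain T t where \<kappa>: "\<kappa> = (T, t)" by (cases \<kappa>)
    let ?N = "\<Sum>l\<in>L. count (D l) \<kappa>"
    have le: "?N \<le> K t" using D(1) \<kappa> by simp
    \<comment> \<open>The share of sets of type \<open>t\<close> avoiding one given point of group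
      \<open>b\<close> is exactly the share of copies that \<open>w\<close> leaves over.\<close>
    have "u b * K' t = (u b - count t b) * K t"
      using num_of_type_without[OF I] by (simp add: K_def K'_def u')
    also have "\<dots> \<ge> (u b - count t b) * ?N" using le by simp
    finally have "u b * ?N \<le> u b * K' t + count t b * ?N"
      by (simp add: diff_mult_distrib)
    then show "u b * lo \<kappa> \<le> (\<Sum>l\<in>L. w l \<kappa>)"
      unfolding lo_def \<kappa> sum_w by (simp add: diff_mult_distrib2 mult.commute)
    show "(\<Sum>l\<in>L. w l \<kappa>) \<le> u b * hi \<kappa>"
    proof (cases "b \<in># t")
      case True
      then obtain t' where t': "t = add_mset b t'" by (metis multi_member_split)
      have "u b * hi \<kappa> = count t b * K t"
        using num_of_type_with[OF I, of u t'] by (simp add: K_def K'_def u' hi_def \<kappa> t')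
      then show ?thesis unfolding sum_w using le by (simp add: \<kappa> mult.commute)
    next
      case False
      then show ?thesis unfolding sum_w by (simp add: \<kappa> not_in_iff)
    qed
  qed (use fin finS ub in auto)
  then obtain f where f: "admissible L S w f"
    and load: "\<And>\<kappa>. \<kappa> \<in> S \<Longrightarrow> lo \<kappa> \<le> load L f \<kappa>" "\<And>\<kappa>. \<kappa> \<in> S \<Longrightarrow> load L f \<kappa> \<le> hi \<kappa>"
    by blast
  define new where "new = (\<lambda>\<kappa> :: 'a set \<times> 'b multiset. (insert v (fst \<kappa>), snd \<kappa> - {#b#}))"
  define D' where "D' = (\<lambda>l. add_mset (new (f l)) (D l - {#f l#}))"
  have fl: "f l \<in># D l" "b \<in># snd (f l)" if "l \<in> L" for l
    using f that by (auto simp: admissible_def w_def)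
  have D_split: "D l = add_mset (f l) (D l - {#f l#})" if "l \<in> L" for l
    using fl[OF that] by simp
  have not_v: "v \<notin> fst \<kappa>" if "l \<in> L" "\<kappa> \<in># D l" for l \<kappa>
    using D(2)[OF that] v by blast
  have u'_eq: "card {x \<in> X - insert v Y. g x = i} = u' i" for i by (simp add: u'_def)
  have "detached L X g M (insert v Y) D'"
    unfolding detached_def u'_eq I_def[symmetric] K'_def[symmetric]
  proof (intro conjI allI ballI)
    fix T t
    show "(\<Sum>l\<in>L. count (D' l) (T, t)) \<le> K' t"
    proof (cases "v \<in> T")
      case True
      \<comment> \<open>Keys containing \<open>v\<close> come only from \<open>new\<close>, and
        \<open>(T, t)\<close> determines the key that was chosen.\<close>
      let ?\<kappa> = "(T - {v}, add_mset b t)"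
      have "count (D' l) (T, t) = (if f l = ?\<kappa> then 1 else 0)" if l: "l \<in> L" for l
      proof -
        have "(T, t) \<notin># D l" using not_v[OF l] True by auto
        moreover have "new (f l) = (T, t) \<longleftrightarrow> f l = ?\<kappa>"
          using fl[OF l] not_v[OF l fl(1)[OF l]] True by (cases "f l") (auto simp: new_def)
        ultimately show ?thesis by (simp add: D'_def not_in_iff)
      qed
      then have eq: "(\<Sum>l\<in>L. count (D' l) (T, t)) = load L f ?\<kappa>"
        using fin by (simp add: load_def sum.If_cases Int_def)
      show ?thesis
      proof (cases "?\<kappa> \<in> S")
        case True
        then show ?thesis using load(2)[OF True] eq by (simp add: hi_def)
      next
        case False
        then have "{l \<in> L. f l = ?\<kappa>} = {}" using f by (auto simp: admissible_def)
        then show ?thesis unfolding eq load_def by (simp only: card.empty zero_le)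
      qed
    next
      case False
      have "count (D' l) (T, t) + (if f l = (T, t) then 1 else 0) = count (D l) (T, t)" if l: "l \<in> L" for l
      proof -
        have "new (f l) \<noteq> (T, t)" using False by (auto simp: new_def)
        then show ?thesis using fl(1)[OF l] by (auto simp: D'_def)
      qed
      then have "(\<Sum>l\<in>L. count (D l) (T, t)) = (\<Sum>l\<in>L. count (D' l) (T, t) + (if f l = (T, t) then 1 else 0))"
        by simp
      also have "\<dots> = (\<Sum>l\<in>L. count (D' l) (T, t)) + load L f (T, t)"
        unfolding sum.distrib using fin by (simp add: load_def sum.If_cases Int_def)
      finally have eq: "(\<Sum>l\<in>L. count (D' l) (T, t)) + load L f (T, t) = (\<Sum>l\<in>L. count (D l) (T, t))" by simp
      show ?thesis
      proof (cases "(T, t) \<in> S")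
        case True
        then show ?thesis using load(1)[OF True] eq by (simp add: lo_def)
      next
        case False
        then have "(\<Sum>l\<in>L. count (D l) (T, t)) = 0" by (auto simp: S_def not_in_iff)
        then show ?thesis using eq by simp
      qed
    qed
  next
    fix l \<kappa> assume l: "l \<in> L" and "\<kappa> \<in># D' l"
    then have "\<kappa> = new (f l) \<or> \<kappa> \<in># D l" by (auto simp: D'_def dest: in_diffD)
    then show "fst \<kappa> \<subseteq> insert v Y" using D(2)[OF l, of \<kappa>] D(2)[OF l fl(1)[OF l]] by (auto simp: new_def)
  next
    fix l i assume l: "l \<in> L"
    have "u i = count (snd (f l)) i + (\<Sum>\<kappa>\<in>#D l - {#f l#}. count (snd \<kappa>) i)"
      unfolding D(3)[OF l, symmetric] by (subst D_split[OF l]) simp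
    moreover have "count (snd (f l)) b > 0" using fl[OF l] by simp
    ultimately show "(\<Sum>\<kappa>\<in>#D' l. count (snd \<kappa>) i) = u' i"
      by (auto simp: D'_def new_def u')
  next
    fix l y assume l: "l \<in> L" and y: "y \<in> insert v Y"
    show "size {#\<kappa> \<in># D' l. y \<in> fst \<kappa>#} = 1"
    proof (cases "y = v")
      case True
      have "{#\<kappa> \<in># D l. v \<in> fst \<kappa>#} = {#}"
        using not_v[OF l] by (auto simp: filter_mset_eq_mempty_iff)
      then show ?thesis using not_v[OF l fl(1)[OF l]] by (simp add: D'_def new_def True)
    next
      case False
      then have "size {#\<kappa> \<in># D l. y \<in> fst \<kappa>#} = 1" using D(4) l y by auto
      then show ?thesis
        by (subst (asm) D_split[OF l]) (use False in \<open>auto simp: D'_def new_def split: if_splits\<close>)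
    qed
  next
    fix l assume l: "l \<in> L"
    let ?c = "\<lambda>\<kappa>. image_mset g (mset_set (fst \<kappa>)) + snd \<kappa>"
    have "finite (fst (f l))" using D(2)[OF l fl(1)[OF l]] v fin by (meson finite_subset)
    then have "?c (new (f l)) = ?c (f l)"
      using not_v[OF l fl(1)[OF l]] fl(2)[OF l] by (simp add: new_def b_def)
    then have "image_mset ?c (D' l) = image_mset ?c (add_mset (f l) (D l - {#f l#}))"
      by (simp add: D'_def)
    then show "image_mset ?c (D' l) = M l"
      using D(5)[OF l] D_split[OF l] by simp
  qed
  then show ?thesis by blast
qed

text \<open>Baranyai's method, one point at a time. A key \<open>(T, t)\<close> in \<open>D l\<close> is a part of the \<open>l\<close>-th
  partition meeting the already distributed points in \<open>T\<close>, and \<open>t\<close> counts how many of its other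
  points will come from each group. The new point of a group goes to a part with probability
  proportional to the multiplicity of the group in \<open>t\<close>; this is rounded to an integral choice.\<close>

theorem detachment:
  fixes g :: "'a \<Rightarrow> 'b"
  assumes fin: "finite L" "finite X"
    and bound: "\<And>t. (\<Sum>l\<in>L. count (M l) t) \<le> num_of_type (g ` X) (\<lambda>b. card {x \<in> X. g x = b}) t"
    and deg: "\<And>l b. l \<in> L \<Longrightarrow> (\<Sum>t\<in>#M l. count t b) = card {x \<in> X. g x = b}"
    and nonempty: "\<And>l. l \<in> L \<Longrightarrow> {#} \<notin># M l"
  shows "\<exists>P. (\<forall>l\<in>L. partition_on X (P l) \<and>
      image_mset (\<lambda>E. image_mset g (mset_set E)) (mset_set (P l)) = M l) \<and>
    (\<forall>l\<in>L. \<forall>l'\<in>L. l \<noteq> l' \<longrightarrow> P l \<inter> P l' = {})"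
proof -
  have "\<exists>D. detached L X g M Y D" if "finite Y" "Y \<subseteq> X" for Y
    using that
  proof (induction rule: finite_induct)
    case empty
    have "detached L X g M {} (\<lambda>l. image_mset (Pair {}) (M l))"
      unfolding detached_def
    proof (intro conjI allI ballI)
      fix T :: "'a set" and t :: "'b multiset"
      have "count (image_mset (Pair {}) N) (T, t) \<le> count N t" (is "?c N \<le> _") for N :: "'b multiset multiset"
        by (induction N) auto
      then show "(\<Sum>l\<in>L. count (image_mset (Pair {}) (M l)) (T, t))
          \<le> num_of_type (g ` X) (\<lambda>b. card {x \<in> X - {}. g x = b}) t"
        using order_trans[OF sum_mono bound] by simp
    next
      fix l b assume "l \<in> L"
      then show "(\<Sum>\<kappa>\<in>#image_mset (Pair {}) (M l). count (snd \<kappa>) b) = card {x \<in> X - {}. g x = b}"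
        using deg by (simp add: multiset.map_comp o_def)
    qed (auto simp: multiset.map_comp o_def)
    then show ?case by blast
  next
    case (insert v Y)
    then show ?case using detach_point[where v = v and Y = Y and g = g and M = M, OF fin] by auto
  qed
  then obtain D where D: "detached L X g M X D" using fin by blast
  have u0: "card {x \<in> X - X. g x = b} = 0" for b by simp
  \<comment> \<open>With no points left a key has at most one completion, so it occurs at most once
    over all partitions; this makes the parts distinct.\<close>
  have D1: "(\<Sum>l\<in>L. count (D l) \<kappa>) \<le> 1" for \<kappa>
  proof -
    have "0 choose j \<le> (1 :: nat)" for j by (cases j) auto
    then have "num_of_type (g ` X) (\<lambda>b. 0) (snd \<kappa>) \<le> 1"
      unfolding num_of_type_def by (intro prod_le_1) simp
    moreover have "(\<Sum>l\<in>L. count (D l) (fst \<kappa>, snd \<kappa>)) \<le> num_of_type (g ` X) (\<lambda>b. 0) (snd \<kappa>)"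
      using D unfolding detached_def u0 by blast
    ultimately show ?thesis by simp
  qed
  have D_le1: "count (D l) \<kappa> \<le> 1" if "l \<in> L" for l \<kappa>
    using member_le_sum[of l L "\<lambda>l. count (D l) \<kappa>"] fin that D1[of \<kappa>] by (simp add: le_trans)
  have D_snd: "snd \<kappa> = {#}" if "l \<in> L" "\<kappa> \<in># D l" for l \<kappa>
  proof -
    have "count (snd \<kappa>) b = 0" for b
    proof -
      have "(\<Sum>\<kappa>\<in>#D l. count (snd \<kappa>) b) = 0" using D that by (simp add: detached_def)
      then show ?thesis using that(2) by (simp add: sum_mset_0_iff)
    qed
    then show ?thesis by (simp add: multiset_eq_iff)
  qed
  have D_fst: "fst \<kappa> \<subseteq> X" if "l \<in> L" "\<kappa> \<in># D l" for l \<kappa>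
    using D that by (simp add: detached_def)
  have D_cover: "size {#\<kappa> \<in># D l. y \<in> fst \<kappa>#} = 1" if "l \<in> L" "y \<in> X" for l y
    using D that by (simp add: detached_def)
  have D_M: "image_mset (\<lambda>E. image_mset g (mset_set E)) (image_mset fst (D l)) = M l" if "l \<in> L" for l
  proof -
    have "image_mset (\<lambda>\<kappa>. image_mset g (mset_set (fst \<kappa>)) + snd \<kappa>) (D l)
        = image_mset (\<lambda>\<kappa>. image_mset g (mset_set (fst \<kappa>))) (D l)"
      using D_snd[OF that] by (intro image_mset_cong) simp
    then show ?thesis using D that by (simp add: detached_def multiset.map_comp o_def)
  qed
  define P where "P l = fst ` set_mset (D l)" for l
  have P: "mset_set (P l) = image_mset fst (D l)" if l: "l \<in> L" for l
  proof -
    have "D l = mset_set (set_mset (D l))"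
      using D_le1[OF l] by (intro multiset_eqI) (metis count_eq_zero_iff count_mset_set(1,3) finite_set_mset le_antisym less_one not_le)
    moreover have "inj_on fst (set_mset (D l))"
      using D_snd[OF l] by (auto simp: inj_on_def prod_eq_iff)
    ultimately show ?thesis unfolding P_def by (metis image_mset_mset_set)
  qed
  have "partition_on X (P l)" if l: "l \<in> L" for l
  proof (rule partition_onI)
    show "\<Union> (P l) = X"
    proof
      show "\<Union> (P l) \<subseteq> X" using D_fst[OF l] by (auto simp: P_def)
      show "X \<subseteq> \<Union> (P l)"
      proof
        fix y assume "y \<in> X"
        then have "{#\<kappa> \<in># D l. y \<in> fst \<kappa>#} \<noteq> {#}" using D_cover[OF l] by (metis size_empty zero_neq_one)
        then show "y \<in> \<Union> (P l)" by (force simp: P_def filter_mset_eq_mempty_iff)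
      qed
    qed
    show "{} \<notin> P l"
    proof
      assume "{} \<in> P l"
      then obtain \<kappa> where "\<kappa> \<in># D l" "{} = fst \<kappa>" unfolding P_def by blast
      then have "{#} \<in># M l" unfolding D_M[OF l, symmetric] by force
      then show False using nonempty[OF l] by simp
    qed
    show "disjnt E E'" if EE: "E \<in> P l" "E' \<in> P l" "E \<noteq> E'" for E E'
    proof (rule ccontr)
      assume "\<not> disjnt E E'"
      then obtain y where y: "y \<in> E" "y \<in> E'" by (auto simp: disjnt_def)
      obtain \<kappa> \<kappa>' where \<kappa>: "\<kappa> \<in># D l" "\<kappa>' \<in># D l" "fst \<kappa> = E" "fst \<kappa>' = E'"
        using EE by (auto simp: P_def)
      have yX: "y \<in> X" using y \<kappa> D_fst[OF l \<kappa>(1)] by auto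
      obtain \<kappa>0 where "{#\<kappa> \<in># D l. y \<in> fst \<kappa>#} = {#\<kappa>0#}"
        using D_cover[OF l yX] size_1_singleton_mset by metis
      moreover have "\<kappa> \<in># {#\<kappa> \<in># D l. y \<in> fst \<kappa>#}" "\<kappa>' \<in># {#\<kappa> \<in># D l. y \<in> fst \<kappa>#}"
        using \<kappa> y by auto
      ultimately show False using \<kappa> EE by auto
    qed
  qed
  moreover have "P l \<inter> P l' = {}" if ll: "l \<in> L" "l' \<in> L" "l \<noteq> l'" for l l'
  proof (rule ccontr)
    assume "P l \<inter> P l' \<noteq> {}"
    then obtain \<kappa> \<kappa>' where \<kappa>: "\<kappa> \<in># D l" "\<kappa>' \<in># D l'" "fst \<kappa> = fst \<kappa>'" by (auto simp: P_def)
    then have "\<kappa> = \<kappa>'" using D_snd ll by (simp add: prod_eq_iff)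
    then have "count (D l) \<kappa> \<ge> 1" "count (D l') \<kappa> \<ge> 1" using \<kappa> by auto
    moreover have "(\<Sum>i\<in>{l, l'}. count (D i) \<kappa>) \<le> (\<Sum>i\<in>L. count (D i) \<kappa>)"
      using ll fin by (intro sum_mono2) auto
    then have "count (D l) \<kappa> + count (D l') \<kappa> \<le> (\<Sum>i\<in>L. count (D i) \<kappa>)" using ll by simp
    ultimately show False using D1[of \<kappa>] by linarith
  qed
  ultimately show ?thesis using P D_M by metis
qed

section \<open>Round-robin counting, parallel classes, and the reduction to types\<close>

section \<open>Sperner systems from types\<close>

text \<open>Every window of \<open>u\<close> consecutive integers meets each residue class once,
  which allows parts to be dealt round-robin.\<close>

lemma card_residue_window:
  fixes a u z b :: nat
  assumes "b < u"
  shows "card {x \<in> {a..<a + u * z}. x mod u = b} = z"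
proof (induction z)
  case (Suc z)
  let ?W = "{a + u * z..<a + u * z + u}"
  have inj: "inj_on (\<lambda>x. x mod u) ?W"
  proof (rule linorder_inj_onI')
    fix i j assume ij: "i \<in> ?W" "j \<in> ?W" "i < j"
    show "i mod u \<noteq> j mod u"
    proof
      assume "i mod u = j mod u"
      then have "u dvd j - i" using ij by (metis mod_eq_dvd_iff_nat nat_less_le)
      then show False using ij by (auto dest: dvd_imp_le)
    qed
  qed
  have "(\<lambda>x. x mod u) ` ?W = {..<u}"
    using assms inj by (intro card_subset_eq) (auto simp: card_image)
  then obtain x where x: "x \<in> ?W" "x mod u = b" using assms by (metis imageE lessThan_iff)
  then have "{y \<in> ?W. y mod u = b} = {x}" using inj by (auto simp: inj_on_def)
  moreover have "{y \<in> {a..<a + u * Suc z}. y mod u = b}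
      = {y \<in> {a..<a + u * z}. y mod u = b} \<union> {y \<in> ?W. y mod u = b}" by auto
  moreover have "{y \<in> {a..<a + u * z}. y mod u = b} \<inter> {y \<in> ?W. y mod u = b} = {}" by auto
  ultimately show ?case using Suc by (simp add: card_Un_disjoint)
qed simp

lemma card_residue_le:
  fixes a u z b n :: nat
  assumes "b < u" "n \<le> u * z"
  shows "card {x \<in> {a..<a + n}. x mod u = b} \<le> z"
proof -
  have "card {x \<in> {a..<a + n}. x mod u = b} \<le> card {x \<in> {a..<a + u * z}. x mod u = b}"
    using assms by (intro card_mono) auto
  then show ?thesis using card_residue_window[OF assms(1)] by simp
qed

lemma card_residue_ge:
  fixes a u b n :: nat
  assumes "b < u"
  shows "n div u \<le> card {x \<in> {a..<a + n}. x mod u = b}"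
proof -
  have "{a..<a + u * (n div u)} \<subseteq> {a..<a + n}" by simp
  then have "card {x \<in> {a..<a + u * (n div u)}. x mod u = b} \<le> card {x \<in> {a..<a + n}. x mod u = b}"
    by (intro card_mono, simp, blast)
  then show ?thesis using card_residue_window[OF assms] by simp
qed

text \<open>Detachment with a single group: all prescribed parts have the same type, and the
  required partitions consume exactly the number of \<open>c\<close>-sets that exist.\<close>

lemma baranyai:
  assumes X: "finite X" "X \<noteq> {}" and c: "c > 0" "c dvd card X"
  shows "\<exists>F :: nat \<Rightarrow> 'a set set. (\<forall>f < (card X - 1) choose (c - 1). partition_on X (F f) \<and> (\<forall>e\<in>F f. card e = c))
    \<and> (\<forall>f < (card X - 1) choose (c - 1). \<forall>f' < (card X - 1) choose (c - 1). f \<noteq> f' \<longrightarrow> F f \<inter> F f' = {})"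
proof -
  define m where "m = card X"
  define N where "N = (m - 1) choose (c - 1)"
  have m: "m > 0" using X by (simp add: m_def card_gt_0_iff)
  let ?M = "\<lambda>_ :: nat. replicate_mset (m div c) (replicate_mset c ())"
  have "\<exists>P. (\<forall>l\<in>{..<N}. partition_on X (P l) \<and>
      image_mset (\<lambda>E. image_mset (\<lambda>_. ()) (mset_set E)) (mset_set (P l)) = ?M l) \<and>
    (\<forall>l\<in>{..<N}. \<forall>l'\<in>{..<N}. l \<noteq> l' \<longrightarrow> P l \<inter> P l' = {})"
  proof (rule detachment)
    fix t :: "unit multiset"
    have img: "(\<lambda>_. ()) ` X = {()}" using X by auto
    have "c * (m choose c) = m * N"
      using binomial_absorption[of "c - 1" m] c by (simp add: N_def)
    also have "\<dots> = c * (N * (m div c))" using c by (simp add: m_def)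
    finally have "m choose c = N * (m div c)" using c by simp
    then show "(\<Sum>l<N. count (?M l) t) \<le> num_of_type ((\<lambda>_. ()) ` X) (\<lambda>b. card {x \<in> X. () = b}) t"
      unfolding img by (auto simp: num_of_type_def m_def[symmetric])
  qed (use X c in \<open>auto simp: m_def\<close>)
  then obtain P where "\<forall>l\<in>{..<N}. partition_on X (P l) \<and>
      image_mset (\<lambda>E. image_mset (\<lambda>_. ()) (mset_set E)) (mset_set (P l)) = ?M l"
    and disj: "\<forall>l\<in>{..<N}. \<forall>l'\<in>{..<N}. l \<noteq> l' \<longrightarrow> P l \<inter> P l' = {}" by blast
  then have P: "partition_on X (P l)"
      "image_mset (\<lambda>E. image_mset (\<lambda>_. ()) (mset_set E)) (mset_set (P l)) = ?M l" if "l < N" for l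
    using that by blast+
  have "card e = c" if "l < N" "e \<in> P l" for l e
  proof -
    have "finite (P l)" using P(1) X(1) that by (metis finite_elements)
    then have "image_mset (\<lambda>_. ()) (mset_set e) \<in># ?M l"
      unfolding P(2)[OF that(1), symmetric] using that by auto
    then have "image_mset (\<lambda>_. ()) (mset_set e) = replicate_mset c ()" by (simp split: if_splits)
    then show ?thesis by (metis size_image_mset size_mset_set size_replicate_mset)
  qed
  then show ?thesis using P(1) disj unfolding N_def m_def by blast
qed

lemma num_of_type_mset_set:
  assumes "finite I" "e \<subseteq> I" "\<And>b. b \<in> I \<Longrightarrow> u b = h"
  shows "num_of_type I u (mset_set e) = h ^ card e"
proof -
  have "finite e" using assms finite_subset by blast
  then have "num_of_type I u (mset_set e) = (\<Prod>b\<in>e. h)"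
    unfolding num_of_type_def using assms
    by (intro prod.mono_neutral_cong_right) auto
  then show ?thesis by simp
qed

lemma num_of_type_replicate:
  assumes "finite I" "i \<in> I" "\<And>b. b \<in> I \<Longrightarrow> u b = h"
  shows "num_of_type I u (replicate_mset a i) = h choose a"
  using assms by (simp add: num_of_type_remove) (simp add: num_of_type_def)

text \<open>Reduces the construction to a choice of types. The bounds \<open>h ^ c\<close> and
  \<open>h choose (c + 1)\<close> are the numbers of sets of the two kinds of type, as
  \<open>detachment\<close> requires.\<close>

lemma sperner_of_types:
  fixes M :: "'l \<Rightarrow> nat multiset multiset" and n c k r h m :: nat
  assumes n: "n = c * k + r" "n = h * m" and c: "c \<ge> 2" and r: "0 < r" "r < k"
    and L: "finite L"
    and types: "\<And>l t. l \<in> L \<Longrightarrow> t \<in># M l \<Longrightarrow>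
      (\<exists>e \<subseteq> {..<m}. card e = c \<and> t = mset_set e) \<or> (\<exists>i < m. t = replicate_mset (c + 1) i)"
    and bound_c: "\<And>e. e \<subseteq> {..<m} \<Longrightarrow> card e = c \<Longrightarrow> (\<Sum>l\<in>L. count (M l) (mset_set e)) \<le> h ^ c"
    and bound_Suc_c: "\<And>i. i < m \<Longrightarrow> (\<Sum>l\<in>L. count (M l) (replicate_mset (c + 1) i)) \<le> h choose (c + 1)"
    and deg: "\<And>l b. l \<in> L \<Longrightarrow> b < m \<Longrightarrow> (\<Sum>t\<in>#M l. count t b) = h"
    and size: "\<And>l. l \<in> L \<Longrightarrow> size (M l) = k"
  shows "\<exists>(X :: nat set) S. sperner_partition_system n k X S \<and> almost_uniform n k S \<and> card S = card L"
proof -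
  define X where "X = {..<n}"
  \<comment> \<open>The groups are the residue classes modulo \<open>m\<close>, each with
    \<open>h\<close> points of \<open>X\<close>.\<close>
  define g where "g = (\<lambda>x :: nat. x mod m)"
  have "n > 0" using n(1) r by simp
  then have hm: "h > 0" "m > 0" using n(2) by auto
  have fib: "card {x \<in> X. g x = b} = (if b < m then h else 0)" for b
  proof (cases "b < m")
    case True
    then show ?thesis
      using card_residue_window[OF True, of 0 h] n(2)
      by (simp add: X_def g_def lessThan_atLeast0 mult.commute)
  next
    case False
    have "x mod m < m" for x using hm by simp
    then have "{x \<in> X. g x = b} = {}" using False by (auto simp: g_def)
    then have "card {x \<in> X. g x = b} = 0" by (simp only: card.empty)
    then show ?thesis using False by simp
  qed
  have gX: "g ` X = {..<m}"
  proof
    show "g ` X \<subseteq> {..<m}" using hm by (auto simp: g_def)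
    have "n \<ge> m" using n(2) hm by simp
    then have "g b = b" "b \<in> X" if "b < m" for b using that by (simp_all add: g_def X_def)
    then show "{..<m} \<subseteq> g ` X" by (metis imageI lessThan_iff subsetI)
  qed
  have "\<exists>P. (\<forall>l\<in>L. partition_on X (P l) \<and>
      image_mset (\<lambda>E. image_mset g (mset_set E)) (mset_set (P l)) = M l) \<and>
    (\<forall>l\<in>L. \<forall>l'\<in>L. l \<noteq> l' \<longrightarrow> P l \<inter> P l' = {})"
  proof (rule detachment[OF L])
    fix t
    show "(\<Sum>l\<in>L. count (M l) t) \<le> num_of_type (g ` X) (\<lambda>b. card {x \<in> X. g x = b}) t"
    proof (cases "\<exists>l\<in>L. t \<in># M l")
      case True
      then consider e where "e \<subseteq> {..<m}" "card e = c" "t = mset_set e"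
        | i where "i < m" "t = replicate_mset (c + 1) i" using types by blast
      then show ?thesis
      proof cases
        case 1
        have "num_of_type {..<m} (\<lambda>b. card {x \<in> X. g x = b}) t = h ^ c"
          unfolding 1(3) using 1 by (subst num_of_type_mset_set[where h = h]) (auto simp: fib)
        then show ?thesis unfolding gX using bound_c 1 by simp
      next
        case 2
        have "num_of_type {..<m} (\<lambda>b. card {x \<in> X. g x = b}) t = h choose (c + 1)"
          unfolding 2(2) using 2(1) by (intro num_of_type_replicate) (auto simp: fib)
        then show ?thesis unfolding gX using bound_Suc_c[OF 2(1)] 2(2) by simp
      qed
    next
      case False
      then have "(\<Sum>l\<in>L. count (M l) t) = 0" by (simp add: not_in_iff)
      then show ?thesis by simp
    qed
  next
    fix l b assume l: "l \<in> L"
    show "(\<Sum>t\<in>#M l. count t b) = card {x \<in> X. g x = b}"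
    proof (cases "b < m")
      case False
      have "count t b = 0" if "t \<in># M l" for t
        using types[OF l that] False by (auto simp: count_mset_set')
      then show ?thesis using False by (simp add: fib)
    qed (simp add: fib deg l)
  next
    fix l assume l: "l \<in> L"
    have "t \<noteq> {#}" if "t \<in># M l" for t
      using types[OF l that] c by (auto simp: mset_set_empty_iff card_eq_0_iff)
    then show "{#} \<notin># M l" by blast
  qed (simp add: X_def)
  then obtain P where P: "\<And>l. l \<in> L \<Longrightarrow> partition_on X (P l)"
      "\<And>l. l \<in> L \<Longrightarrow> image_mset (\<lambda>E. image_mset g (mset_set E)) (mset_set (P l)) = M l"
      "\<And>l l'. l \<in> L \<Longrightarrow> l' \<in> L \<Longrightarrow> l \<noteq> l' \<Longrightarrow> P l \<inter> P l' = {}" by blast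
  have finX: "finite X" by (simp add: X_def)
  have finP: "finite (P l)" if "l \<in> L" for l using P(1)[OF that] finX by (metis finite_elements)
  have cardP: "card (P l) = k" if "l \<in> L" for l
    using size[OF that] P(2)[OF that] by (metis size_image_mset size_mset_set)
  have finA: "finite A" if "l \<in> L" "A \<in> P l" for l A
    using P(1)[OF that(1)] that(2) finX by (metis Union_upper finite_subset partition_onD1)
  have typeA: "(\<exists>e \<subseteq> {..<m}. card e = c \<and> image_mset g (mset_set A) = mset_set e)
      \<or> (\<exists>i < m. image_mset g (mset_set A) = replicate_mset (c + 1) i)"
    if "l \<in> L" "A \<in> P l" for l A
  proof -
    have "image_mset g (mset_set A) \<in># M l"
      unfolding P(2)[OF that(1), symmetric] using that finP by auto
    then show ?thesis using types that by blast
  qed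
  have szA: "card A = size (image_mset g (mset_set A))" for A by simp
  have cardA: "card A = c \<or> card A = c + 1" if "l \<in> L" "A \<in> P l" for l A
    using typeA[OF that] by (metis size_mset_set size_replicate_mset szA)
  have antichain: "\<not> A \<subseteq> B" if l: "l \<in> L" "l' \<in> L" "l \<noteq> l'" and AB: "A \<in> P l" "B \<in> P l'" for l l' A B
  proof
    assume sub: "A \<subseteq> B"
    \<comment> \<open>Distinctness makes the containment proper and forces sizes \<open>c\<close>
      and \<open>c + 1\<close>; then the \<open>c \<ge> 2\<close> groups met by \<open>A\<close>
      would have to be the single group of \<open>B\<close>.\<close>
    have "A \<noteq> B" using P(3)[OF l] AB by blast
    then have "card A < card B" using sub finA[OF l(2) AB(2)] by (meson psubsetI psubset_card_mono)
    then have cards: "card A = c" "card B = c + 1"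
      using cardA[OF l(1) AB(1)] cardA[OF l(2) AB(2)] by auto
    obtain e where e: "card e = c" "image_mset g (mset_set A) = mset_set e"
      using typeA[OF l(1) AB(1)] cards by (metis n_not_Suc_n Suc_eq_plus1 size_replicate_mset szA)
    obtain i where i: "image_mset g (mset_set B) = replicate_mset (c + 1) i"
      using typeA[OF l(2) AB(2)] cards by (metis n_not_Suc_n Suc_eq_plus1 size_mset_set szA)
    have "g x = i" if "x \<in> B" for x
    proof -
      have "g x \<in># image_mset g (mset_set B)" using that finA[OF l(2) AB(2)] by auto
      then show ?thesis unfolding i by (simp split: if_splits)
    qed
    then have "set_mset (image_mset g (mset_set A)) \<subseteq> {i}"
      using sub finA[OF l(1) AB(1)] by auto
    moreover have "finite e" using e c by (metis card.infinite not_numeral_le_zero)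
    ultimately have "e \<subseteq> {i}" unfolding e by simp
    then have "card e \<le> 1" using card_mono[of "{i}" e] by simp
    then show False using e c by simp
  qed
  \<comment> \<open>Equal partitions with different labels would be disjoint from themselves, hence
    empty, although each has \<open>k > 0\<close> parts.\<close>
  have inj: "inj_on P L"
  proof (rule inj_onI, rule ccontr)
    fix l l' assume *: "l \<in> L" "l' \<in> L" "P l = P l'" "l \<noteq> l'"
    then have "P l = {}" using P(3) by blast
    then show False using cardP[OF *(1)] r by simp
  qed
  have "sperner_partition_system n k X (P ` L)"
    unfolding sperner_partition_system_def
  proof (intro conjI)
    have "1 * k \<le> c * k" using c by (intro mult_le_mono1) simp
    then show "k \<le> n" using n(1) by linarith
    show "1 \<le> k" using r by simp
    show "\<forall>R\<in>P ` L. \<forall>Q\<in>P ` L. R \<noteq> Q \<longrightarrow> (\<forall>A\<in>R. \<forall>B\<in>Q. \<not> A \<subseteq> B)"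
      using antichain by blast
  qed (use P(1) cardP in \<open>auto simp: X_def\<close>)
  moreover have "almost_uniform n k (P ` L)"
  proof -
    have k0: "real k > 0" using r by simp
    have fl: "\<lfloor>real n / real k\<rfloor> = int c"
      using r k0 n(1) by (intro floor_unique) (simp_all add: field_simps flip: of_nat_mult of_nat_add)
    have ce: "\<lceil>real n / real k\<rceil> = int c + 1"
      using r k0 n(1) by (intro ceiling_unique) (simp_all add: field_simps flip: of_nat_mult of_nat_add)
    show ?thesis unfolding almost_uniform_def fl ce using cardA by fastforce
  qed
  moreover have "card (P ` L) = card L" using inj by (rule card_image)
  ultimately show ?thesis by blast
qed

section \<open>Dealing the large parts evenly over blocks and partitions\<close>

section \<open>Spreading the large parts\<close>

text \<open>The parts of one partition inside a block \<open>e\<close> of \<open>c\<close> groups: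
  the \<open>q\<close> large parts in each group use \<open>(c + 1) * q\<close> of its points, and
  each transversal uses one of the remaining points in every group.\<close>

definition block_types :: "nat \<Rightarrow> nat \<Rightarrow> 'b set \<Rightarrow> nat \<Rightarrow> 'b multiset multiset" where
  "block_types h c e q = replicate_mset (h - (c + 1) * q) (mset_set e)
    + (\<Sum>i\<in>e. replicate_mset q (replicate_mset (c + 1) i))"

lemma in_block_types:
  assumes "t \<in># block_types h c e q" "finite e"
  shows "t = mset_set e \<or> (\<exists>i\<in>e. t = replicate_mset (c + 1) i)"
  using assms by (auto simp: block_types_def set_mset_sum split: if_splits)

lemma count_block_types_mset_set:
  assumes "finite e" "finite e'" "card e' = c"
  shows "count (block_types h c e q) (mset_set e') = (if e = e' then h - (c + 1) * q else 0)"
proof -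
  have "replicate_mset (c + 1) i \<noteq> mset_set e'" for i
    using assms(3) by (metis n_not_Suc_n Suc_eq_plus1 size_mset_set size_replicate_mset)
  note this this[symmetric]
  then show ?thesis
    using assms by (auto simp: block_types_def count_sum mset_set_eq_iff simp del: replicate_mset_Suc)
qed

lemma count_block_types_replicate:
  assumes "finite e" "card e = c"
  shows "count (block_types h c e q) (replicate_mset (c + 1) i) = (if i \<in> e then q else 0)"
proof -
  have "mset_set e \<noteq> replicate_mset (c + 1) i"
    using assms(2) by (metis n_not_Suc_n Suc_eq_plus1 size_mset_set size_replicate_mset)
  moreover have "replicate_mset (c + 1) j = replicate_mset (c + 1) i \<longleftrightarrow> j = i" for i j :: 'a
    by (metis count_replicate_mset nat.distinct(1) Suc_eq_plus1)
  ultimately show ?thesis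
    using assms by (simp add: block_types_def count_sum del: replicate_mset_Suc)
qed

lemma size_block_types:
  assumes "card e = c" "finite e"
  shows "size (block_types h c e q) = h - (c + 1) * q + c * q"
proof -
  have "size (\<Sum>i\<in>e. replicate_mset q (replicate_mset (c + 1) i)) = (\<Sum>i\<in>e. q)"
    using assms(2) by induction auto
  then show ?thesis using assms by (simp add: block_types_def)
qed

lemma degree_block_types:
  assumes "finite e" "(c + 1) * q \<le> h"
  shows "(\<Sum>t\<in>#block_types h c e q. count t b) = (if b \<in> e then h else 0)"
proof -
  have "(\<Sum>t\<in>#(\<Sum>i\<in>e. replicate_mset q (replicate_mset (c + 1) i)). count t b)
      = (if b \<in> e then (c + 1) * q else 0)"
    using assms(1) by (induction e) auto
  then show ?thesis using assms by (auto simp: block_types_def)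
qed

text \<open>Here \<open>r = c * R\<close> and each class has \<open>u\<close> blocks. Partition
  \<open>j\<close> receives the integers from \<open>j * R\<close> to \<open>j * R + R - 1\<close>,
  and \<open>x\<close> stands for one large part in each group of block \<open>x mod u\<close>.
  \<open>H_c\<close> limits the transversals of a block, \<open>H_Suc_c\<close> the large parts in a
  group over all partitions, and \<open>H_fit\<close> makes those of one partition fit.\<close>

lemma sperner_of_block_multiplicities:
  fixes n c k R h m u p :: nat
  assumes n: "n = c * k + c * R" "n = h * m" and c: "c \<ge> 2" and R: "0 < R" "c * R < k"
    and m: "m = c * u"
    and H_c: "p * h \<le> h ^ c + (c + 1) * (p * R div u)"
    and H_Suc_c: "p * R \<le> u * z" "((m - 1) choose (c - 1)) * z \<le> h choose (c + 1)"
    and H_fit: "R \<le> u * q" "(c + 1) * q \<le> h"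
  shows "\<exists>(X :: nat set) S. sperner_partition_system n k X S \<and> almost_uniform n k S \<and>
    card S = p * ((m - 1) choose (c - 1))"
proof -
  define N where "N = (m - 1) choose (c - 1)"
  have "n > 0" using n(1) R c by simp
  then have u: "u > 0" and m0: "m > 0" using n(2) m by auto
  have "\<exists>F. (\<forall>f < N. partition_on {..<m} (F f) \<and> (\<forall>e\<in>F f. card e = c))
      \<and> (\<forall>f < N. \<forall>f' < N. f \<noteq> f' \<longrightarrow> F f \<inter> F f' = {})"
  proof -
    have "{..<m} \<noteq> {}" "0 < c" "c dvd card {..<m}"
      using c m m0 by (auto simp: lessThan_empty_iff)
    from baranyai[OF finite_lessThan this] show ?thesis unfolding N_def card_lessThan .
  qed
  then obtain F where F': "\<forall>f<N. partition_on {..<m} (F f) \<and> (\<forall>e\<in>F f. card e = c)"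
    and disj: "\<forall>f<N. \<forall>f'<N. f \<noteq> f' \<longrightarrow> F f \<inter> F f' = {}" by (elim exE conjE)
  have F: "partition_on {..<m} (F f)" "\<And>e. e \<in> F f \<Longrightarrow> card e = c" if "f < N" for f
    using F' that by simp_all
  have finF: "finite (F f)" if "f < N" for f using F(1)[OF that] by (metis finite_elements finite_lessThan)
  have sub: "e \<subseteq> {..<m}" if "f < N" "e \<in> F f" for f e
    using F(1)[OF that(1)] that(2) by (auto simp: partition_on_def)
  have fine: "finite e" if "f < N" "e \<in> F f" for f e
    using sub[OF that] finite_subset by blast
  have cover: "\<exists>!e. e \<in> F f \<and> i \<in> e" if "f < N" "i < m" for f i
    using F(1)[OF that(1)] that(2) by (auto simp: partition_on_def disjoint_def)
  have cardF: "card (F f) = u" if f: "f < N" for f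
  proof -
    have "m = (\<Sum>e\<in>F f. card e)"
      using F(1)[OF f] fine[OF f] card_Union_disjoint[of "F f"] by (auto simp: partition_on_def)
    also have "\<dots> = card (F f) * c" using F(2)[OF f] by simp
    finally show ?thesis using m c by simp
  qed
  have "\<exists>ix. bij_betw ix (F f) {..<u}" if "f < N" for f
    using finF[OF that] cardF[OF that] finite_same_card_bij[of "F f" "{..<u}"] by simp
  then obtain ix where ix: "\<And>f. f < N \<Longrightarrow> bij_betw (ix f) (F f) {..<u}" by metis
  have ix_less: "ix f e < u" if "f < N" "e \<in> F f" for f e
    using bij_betwE[OF ix[OF that(1)]] that(2) by blast
  define a where "a j b = card {x \<in> {j * R..<j * R + R}. x mod u = b}" for j b
  have a_le: "(c + 1) * a j b \<le> h" if "b < u" for j b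
  proof -
    have "a j b \<le> q" unfolding a_def using card_residue_le[OF that H_fit(1)] .
    then show ?thesis using H_fit(2) by (meson le_trans mult_le_mono2)
  qed
  \<comment> \<open>The intervals of successive partitions join up, so loads are balanced over many
    partitions as well as within each one.\<close>
  have sum_a: "(\<Sum>j<p'. a j b) = card {x \<in> {0..<0 + p' * R}. x mod u = b}" for p' b
  proof (induction p')
    case (Suc p')
    have "{x \<in> {0..<0 + Suc p' * R}. x mod u = b}
        = {x \<in> {0..<0 + p' * R}. x mod u = b} \<union> {x \<in> {p' * R..<p' * R + R}. x mod u = b}" by auto
    moreover have "{x \<in> {0..<0 + p' * R}. x mod u = b} \<inter> {x \<in> {p' * R..<p' * R + R}. x mod u = b} = {}"
      by auto
    ultimately show ?case using Suc by (simp add: a_def card_Un_disjoint)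
  qed simp
  have sum_a_blocks: "(\<Sum>b<u. a j b) = R" for j
  proof -
    have "(\<Sum>b<u. a j b) = card (\<Union>b<u. {x \<in> {j * R..<j * R + R}. x mod u = b})"
      unfolding a_def by (intro card_UN_disjoint[symmetric]) auto
    also have "(\<Union>b<u. {x \<in> {j * R..<j * R + R}. x mod u = b}) = {j * R..<j * R + R}"
      using u by auto
    finally show ?thesis by simp
  qed
  \<comment> \<open>Label \<open>(j, f)\<close> is the \<open>j\<close>-th partition served by class
    \<open>f\<close>.\<close>
  define L where "L = {..<p} \<times> {..<N}"
  define M where "M = (\<lambda>(j, f). \<Sum>e\<in>F f. block_types h c e (a j (ix f e)))"
  have "\<exists>(X :: nat set) S. sperner_partition_system n k X S \<and> almost_uniform n k S \<and> card S = card L"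
  proof (rule sperner_of_types[where M = M, OF n c _ R(2)])
    fix l t assume "l \<in> L" "t \<in># M l"
    then obtain j f where jf: "l = (j, f)" "f < N" by (auto simp: L_def)
    then obtain e where e: "e \<in> F f" "t \<in># block_types h c e (a j (ix f e))"
      using \<open>t \<in># M l\<close> finF[OF jf(2)] by (auto simp: M_def set_mset_sum)
    show "(\<exists>e \<subseteq> {..<m}. card e = c \<and> t = mset_set e) \<or> (\<exists>i < m. t = replicate_mset (c + 1) i)"
      using in_block_types[OF e(2) fine[OF jf(2) e(1)]] F(2)[OF jf(2) e(1)] sub[OF jf(2) e(1)] by blast
  next
    fix e' assume e': "e' \<subseteq> {..<m}" "card e' = c"
    have fe': "finite e'" using e'(1) finite_subset by blast
    have cnt: "count (M (j, f)) (mset_set e') = (if e' \<in> F f then h - (c + 1) * a j (ix f e') else 0)"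
      if f: "f < N" for j f
    proof -
      have "count (M (j, f)) (mset_set e')
          = (\<Sum>e\<in>F f. if e = e' then h - (c + 1) * a j (ix f e) else 0)"
        unfolding M_def prod.case count_sum
        by (intro sum.cong refl count_block_types_mset_set fine[OF f] fe' e'(2))
      then show ?thesis using finF[OF f] by simp
    qed
    have "(\<Sum>l\<in>L. count (M l) (mset_set e'))
        = (\<Sum>f<N. \<Sum>j<p. if e' \<in> F f then h - (c + 1) * a j (ix f e') else 0)"
      unfolding L_def sum.cartesian_product' by (subst sum.swap) (simp add: cnt)
    also have "\<dots> \<le> h ^ c"
    proof (cases "\<exists>f<N. e' \<in> F f")
      case True
      \<comment> \<open>Classes are disjoint, so only the \<open>p\<close> partitions of one class
        use transversals of \<open>e'\<close>.\<close>
      then obtain f where f: "f < N" "e' \<in> F f" by blast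
      then have "e' \<in> F f' \<longleftrightarrow> f' = f" if "f' < N" for f' using disj f that by blast
      then have "(\<Sum>f<N. \<Sum>j<p. if e' \<in> F f then h - (c + 1) * a j (ix f e') else 0)
          = (\<Sum>f'<N. if f' = f then (\<Sum>j<p. h - (c + 1) * a j (ix f' e')) else 0)"
        by (intro sum.cong) auto
      also have "\<dots> = (\<Sum>j<p. h - (c + 1) * a j (ix f e'))" using f by simp
      also have "\<dots> = p * h - (c + 1) * (\<Sum>j<p. a j (ix f e'))"
        using a_le[OF ix_less[OF f]] by (subst sum_subtractf_nat) (auto simp: sum_distrib_left)
      also have "\<dots> \<le> p * h - (c + 1) * (p * R div u)"
        unfolding sum_a using card_residue_ge[OF ix_less[OF f]] by (intro diff_le_mono2 mult_le_mono2)
      also have "\<dots> \<le> h ^ c" using H_c by simp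
      finally show ?thesis .
    qed simp
    finally show "(\<Sum>l\<in>L. count (M l) (mset_set e')) \<le> h ^ c" .
  next
    fix i assume i: "i < m"
    have bnd: "(\<Sum>j<p. count (M (j, f)) (replicate_mset (c + 1) i)) \<le> z" if f: "f < N" for f
    proof -
      \<comment> \<open>Group \<open>i\<close> lies in one block of each class, so a class
        contributes just the load of that block.\<close>
      obtain e where e: "e \<in> F f" "i \<in> e" and uniq: "\<And>e'. e' \<in> F f \<Longrightarrow> i \<in> e' \<longleftrightarrow> e' = e"
        using cover[OF f i] by blast
      have "count (M (j, f)) (replicate_mset (c + 1) i) = a j (ix f e)" for j
      proof -
        have "count (M (j, f)) (replicate_mset (c + 1) i) = (\<Sum>e'\<in>F f. if i \<in> e' then a j (ix f e') else 0)"
          unfolding M_def prod.case count_sum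
          by (intro sum.cong refl count_block_types_replicate fine[OF f] F(2)[OF f])
        also have "\<dots> = (\<Sum>e'\<in>F f. if e' = e then a j (ix f e') else 0)"
          using uniq by (intro sum.cong) auto
        finally show ?thesis using finF[OF f] e(1) by simp
      qed
      then have "(\<Sum>j<p. count (M (j, f)) (replicate_mset (c + 1) i)) = (\<Sum>j<p. a j (ix f e))"
        by (simp only:)
      also have "\<dots> \<le> z" unfolding sum_a by (rule card_residue_le[OF ix_less[OF f e(1)] H_Suc_c(1)])
      finally show ?thesis .
    qed
    have "(\<Sum>l\<in>L. count (M l) (replicate_mset (c + 1) i))
        = (\<Sum>f<N. \<Sum>j<p. count (M (j, f)) (replicate_mset (c + 1) i))"
      unfolding L_def sum.cartesian_product' by (rule sum.swap)
    also have "\<dots> \<le> (\<Sum>f<N. z)" using bnd by (intro sum_mono) simp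
    also have "\<dots> \<le> h choose (c + 1)" using H_Suc_c(2) by (simp add: N_def)
    finally show "(\<Sum>l\<in>L. count (M l) (replicate_mset (c + 1) i)) \<le> h choose (c + 1)" .
  next
    fix l b assume "l \<in> L" and b: "b < m"
    then obtain j f where jf: "l = (j, f)" "f < N" by (auto simp: L_def)
    obtain e where e: "e \<in> F f" "b \<in> e" and uniq: "\<And>e'. e' \<in> F f \<Longrightarrow> b \<in> e' \<longleftrightarrow> e' = e"
      using cover[OF jf(2) b] by blast
    have "(\<Sum>t\<in>#(\<Sum>e\<in>E. B e). count t b) = (\<Sum>e\<in>E. \<Sum>t\<in>#B e. count t b)"
      for E :: "nat set set" and B :: "nat set \<Rightarrow> nat multiset multiset"
      by (induction E rule: infinite_finite_induct) auto
    then have "(\<Sum>t\<in>#M l. count t b) = (\<Sum>e\<in>F f. \<Sum>t\<in>#block_types h c e (a j (ix f e)). count t b)"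
      by (simp add: M_def jf)
    also have "\<dots> = (\<Sum>e'\<in>F f. if b \<in> e' then h else 0)"
      by (intro sum.cong refl degree_block_types fine[OF jf(2)] a_le ix_less[OF jf(2)])
    also have "\<dots> = (\<Sum>e'\<in>F f. if e' = e then h else 0)" using uniq by (intro sum.cong) auto
    also have "\<dots> = h" using finF[OF jf(2)] e(1) by simp
    finally show "(\<Sum>t\<in>#M l. count t b) = h" .
  next
    fix l assume "l \<in> L"
    then obtain j f where jf: "l = (j, f)" "f < N" by (auto simp: L_def)
    have "size (\<Sum>e\<in>E. B e) = (\<Sum>e\<in>E. size (B e))"
      for E :: "nat set set" and B :: "nat set \<Rightarrow> nat multiset multiset"
      by (induction E rule: infinite_finite_induct) auto
    then have "size (M l) = (\<Sum>e\<in>F f. size (block_types h c e (a j (ix f e))))" by (simp add: M_def jf)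
    also have "\<dots> = (\<Sum>e\<in>F f. h - (c + 1) * a j (ix f e) + c * a j (ix f e))"
      by (intro sum.cong refl size_block_types fine[OF jf(2)] F(2)[OF jf(2)])
    also have "\<dots> = (\<Sum>b<u. h - (c + 1) * a j b + c * a j b)"
      by (rule sum.reindex_bij_betw[OF ix[OF jf(2)]])
    \<comment> \<open>A unit of load replaces \<open>c + 1\<close> transversals by \<open>c\<close>
      large parts; adding the lost part back makes every block contribute \<open>h\<close>.\<close>
    finally have "size (M l) + (\<Sum>b<u. a j b) = (\<Sum>b<u. h - (c + 1) * a j b + c * a j b + a j b)"
      by (simp add: sum.distrib)
    also have "\<dots> = (\<Sum>b<u. h)"
    proof (rule sum.cong)
      fix b assume "b \<in> {..<u}"
      then have "(c + 1) * a j b \<le> h" using a_le by simp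
      then show "h - (c + 1) * a j b + c * a j b + a j b = h" by simp
    qed simp
    finally have "size (M l) + R = h * u" by (simp add: sum_a_blocks mult.commute)
    moreover have "c * (k + R) = c * (h * u)" using n m by (simp add: algebra_simps)
    ultimately show "size (M l) = k" using c by simp
  qed (use R c in \<open>auto simp: L_def\<close>)
  moreover have "card L = p * N" by (simp add: L_def)
  ultimately show ?thesis by (simp add: N_def)
qed

section \<open>From the floor expressions for \<open>p\<close> to the bounds on types\<close>

section \<open>The numerical conditions\<close>

lemma binomial_superadditive: "j > 0 \<Longrightarrow> (a choose j) + (b choose j) \<le> (a + b) choose j"
proof (induction b)
  case 0
  then show ?case by (cases j) auto
next
  case (Suc b)
  then obtain i where j: "j = Suc i" by (cases j) auto
  have "b choose i \<le> (a + b) choose i" by (rule binomial_right_mono) simp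
  then show ?case using Suc by (simp add: j)
qed

lemma binomial_mult_le: "j > 0 \<Longrightarrow> u * (h choose j) \<le> (h * u) choose j"
proof (induction u)
  case (Suc u)
  then show ?case using binomial_superadditive[of j h "h * u"] by simp
qed simp

text \<open>With groups of size \<open>h\<close>, the parts of size \<open>c + 1\<close> fit only if at most
  \<open>m * (h div (c + 1))\<close> of them are needed. Otherwise coarser groups of size \<open>h * u\<close> work,
  since then few parts of size \<open>c\<close> are needed.\<close>

lemma coarse_bound:
  fixes c k R h u Q :: nat
  assumes c: "c \<ge> 2" and hu: "h * u = k + R" and R: "c * R < k"
    and Q: "Q * R \<le> u * (h choose (c + 1))" and large: "u * (h div (c + 1)) < R"
  shows "Q * (k - c * R) \<le> (h * u) ^ c"
proof (cases "h div (c + 1) = 0 \<or> u = 0")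
  case True
  \<comment> \<open>No large part is available here, so \<open>Q * R\<close> and hence
    \<open>Q\<close> vanishes.\<close>
  have "0 < R" using large by simp
  moreover have "u * (h choose (c + 1)) = 0" using True by (auto simp: div_eq_0_iff)
  then have "Q * R = 0" using Q by linarith
  ultimately have "Q = 0" by simp
  then show ?thesis by simp
next
  case False
  define q where "q = h div (c + 1)"
  define b where "b = h choose (c + 1)"
  have q: "q \<ge> 1" and u0: "u > 0" using False by (auto simp: q_def)
  have h_le: "h \<le> (c + 1) * q + c"
    using mod_less_divisor[of "c + 1" h] mult_div_mod_eq[of "c + 1" h] unfolding q_def by linarith
  have Rq: "u * q + 1 \<le> R" using large by (simp add: q_def)
  have kR: "k - c * R + (c + 1) * R = h * u" using hu R by simp
  \<comment> \<open>The \<open>k - c * R\<close> parts of size \<open>c\<close> are few: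
    \<open>R\<close> exceeds \<open>u * q\<close>, while \<open>h\<close> exceeds
    \<open>(c + 1) * q\<close> by at most \<open>c\<close>.\<close>
  have "(c + 1) * (u * q + 1) \<le> (c + 1) * R" using Rq by (rule mult_le_mono2)
  moreover have "h * u \<le> ((c + 1) * q + c) * u" using h_le by (rule mult_le_mono1)
  ultimately have few': "k - c * R + (c + 1) \<le> c * u" using kR by (simp add: algebra_simps)
  then have few: "k - c * R \<le> c * u" by simp
  have u2: "u \<ge> 2"
  proof (rule ccontr)
    assume "\<not> u \<ge> 2"
    then have "c * u \<le> c * 1" by (intro mult_le_mono2) simp
    then show False using few' by linarith
  qed
  have "Q * (u * q) \<le> Q * R" using Rq by (intro mult_le_mono2) simp
  also have "\<dots> \<le> u * b" using Q by (simp add: b_def)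
  finally have "u * (Q * q) \<le> u * b" by (simp add: algebra_simps)
  then have Qq: "Q * q \<le> b" using u0 by simp
  have hq: "h \<le> (2 * c + 1) * q"
  proof -
    have "c * 1 \<le> c * q" using q by (rule mult_le_mono2)
    then have "h \<le> (c + 1) * q + c * q" using h_le by linarith
    then show ?thesis by (simp add: algebra_simps)
  qed
  define d where "d = (h - 1) choose c"
  \<comment> \<open>Absorption turns \<open>(c + 1) * b\<close> into \<open>h * d\<close>, and the
    linear bound on \<open>h\<close> then lets \<open>q\<close> cancel.\<close>
  have "q * ((c + 1) * Q) \<le> (c + 1) * b" using Qq by (metis mult.commute mult.left_commute mult_le_mono2)
  also have "\<dots> = h * d" using binomial_absorption[of c h] by (simp add: b_def d_def)
  also have "\<dots> \<le> (2 * c + 1) * q * d" using hq by (rule mult_le_mono1)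
  also have "\<dots> = q * ((2 * c + 1) * d)" by (simp only: ac_simps)
  finally have "(c + 1) * Q \<le> (2 * c + 1) * d" using q by simp
  also have "\<dots> \<le> (c + 1) * (2 * d)" by (simp add: algebra_simps)
  finally have "Q \<le> 2 * d" unfolding mult_le_cancel1 by simp
  also have "\<dots> \<le> d * fact c"
  proof -
    have "fact 2 \<le> (fact c :: nat)" using c by (rule fact_mono_nat)
    then show ?thesis by (simp add: fact_2 mult.commute)
  qed
  also have "\<dots> \<le> (h - 1) ^ c" unfolding d_def by (rule binomial_fact_pow)
  also have "\<dots> \<le> h ^ c" by (intro power_mono) auto
  finally have "Q \<le> h ^ c" .
  then have "Q * (k - c * R) \<le> h ^ c * (c * u)" using few by (intro mult_le_mono)
  \<comment> \<open>This uses \<open>u \<ge> 2\<close> through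
    \<open>c \<le> 2 ^ (c - 1)\<close>.\<close>
  also have "c * u \<le> u ^ c"
  proof -
    have "c \<le> 2 ^ (c - 1)" using c
    proof (induction c rule: dec_induct)
      case (step i)
      then have "i + 1 \<le> 2 * 2 ^ (i - 1)" by simp
      also have "\<dots> = 2 ^ (Suc i - 1)" using step by (simp flip: power_Suc)
      finally show ?case by simp
    qed simp
    also have "\<dots> \<le> u ^ (c - 1)" using u2 by (intro power_mono) auto
    finally have "c * u \<le> u ^ (c - 1) * u" by (rule mult_le_mono1)
    also have "\<dots> = u ^ c" using c by (cases c) (auto simp: mult.commute)
    finally show ?thesis .
  qed
  finally show ?thesis by (simp add: power_mult_distrib)
qed

text \<open>Removes the fitting condition. If it fails, the points are regrouped into
  \<open>c\<close> groups of size \<open>h * u\<close>, forming a single block and a single class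
  that serves all \<open>Q\<close> partitions; \<open>coarse_bound\<close> supplies enough
  transversals.\<close>

lemma sperner_of_bounds:
  fixes n c k R h m u p z :: nat
  assumes n: "n = c * k + c * R" "n = h * m" and c: "c \<ge> 2" and R: "0 < R" "c * R < k"
    and m: "m = c * u"
    and H_c: "p * h \<le> h ^ c + (c + 1) * (p * R div u)"
    and H_Suc_c: "p * R \<le> u * z" "((m - 1) choose (c - 1)) * z \<le> h choose (c + 1)"
  shows "\<exists>(X :: nat set) S. sperner_partition_system n k X S \<and> almost_uniform n k S \<and>
    card S = p * ((m - 1) choose (c - 1))"
proof (cases "R \<le> u * (h div (c + 1))")
  case True
  show ?thesis
    by (rule sperner_of_block_multiplicities[OF n c R m H_c H_Suc_c True]) (rule times_div_less_eq_dividend)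
next
  case False
  define Q where "Q = p * ((m - 1) choose (c - 1))"
  have "c * (h * u) = c * (k + R)" using n m by (simp add: algebra_simps)
  then have hu: "h * u = k + R" using c by simp
  have "Q * R = p * R * ((m - 1) choose (c - 1))" by (simp add: Q_def)
  also have "\<dots> \<le> u * z * ((m - 1) choose (c - 1))" using H_Suc_c(1) by (rule mult_le_mono1)
  also have "\<dots> = u * (((m - 1) choose (c - 1)) * z)" by simp
  also have "\<dots> \<le> u * (h choose (c + 1))" using H_Suc_c(2) by (rule mult_le_mono2)
  finally have QR: "Q * R \<le> u * (h choose (c + 1))" .
  have "Q * (k - c * R) \<le> (h * u) ^ c"
    using coarse_bound[OF c hu R(2) QR] False by simp
  moreover have "h * u = (k - c * R) + (c + 1) * R" using hu R by simp
  ultimately have "Q * (h * u) \<le> (h * u) ^ c + (c + 1) * (Q * R)"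
    by (metis add_le_mono1 distrib_left mult.left_commute)
  moreover have "Q * R \<le> (h * u) choose (c + 1)"
    using QR binomial_mult_le[of "c + 1" u h] by simp
  ultimately have "\<exists>(X :: nat set) S. sperner_partition_system n k X S \<and> almost_uniform n k S \<and>
    card S = Q * ((c - 1) choose (c - 1))"
    using n m hu R
    by (intro sperner_of_block_multiplicities[where h = "h * u" and u = 1 and z = "Q * R" and q = R,
          OF n(1) _ c R]) (simp_all add: algebra_simps)
  then show ?thesis by (simp add: Q_def)
qed

lemma floor_ge_divide_nat:
  fixes p d :: nat
  assumes "d > 0" "int p \<le> \<lfloor>x / real d\<rfloor>"
  shows "real (p * d) \<le> x"
proof -
  have "real p \<le> x / real d" using assms(2) by (simp add: le_floor_iff)
  then show ?thesis using assms(1) by (simp add: pos_le_divide_eq)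
qed

theorem lemma3p2:
  fixes n c k r h m p :: nat
    and p1 p2 p1' p2' :: int
  assumes "n = c * k + r" and "c \<ge> 2" and "k \<ge> 3" and "r \<in> {1..k - 1}"
    and "n = h * m" and "m > 0" and "h > 0" and "c dvd m"
    and "p1 = \<lfloor>real m * (real h ^ c - real c - 1) / (real c * (real k - real r))\<rfloor>"
    and "p2 = \<lfloor>real m / real r *
                real_of_int \<lfloor>real (h choose (c + 1)) / real ((m - 1) choose (c - 1))\<rfloor>\<rfloor>"
    and "p1' = \<lfloor>real m * real h ^ c / (real c * (real k - real r))\<rfloor>"
    and "p2' = \<lfloor>real m * real (h choose (c + 1)) / (real r * real ((m - 1) choose (c - 1)))\<rfloor>"
    and "int p = min p1 p2 \<or> (int p = min p1' p2' \<and> m dvd p * r)"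
  shows "\<exists>(X :: nat set) S. sperner_partition_system n k X S \<and> almost_uniform n k S \<and>
           card S = p * ((m - 1) choose (c - 1))"
proof -
  define N where "N = (m - 1) choose (c - 1)"
  define b where "b = h choose (c + 1)"
  obtain u where m: "m = c * u" using \<open>c dvd m\<close> by blast
  have "c dvd n" using \<open>n = h * m\<close> m by simp
  then have "c dvd r" using \<open>n = c * k + r\<close> by (metis dvd_add_right_iff dvd_triv_left)
  then obtain R where r: "r = c * R" by blast
  have c0: "c > 0" and u0: "u > 0" and R: "R > 0" "c * R < k"
    using assms m r by auto
  have "m \<ge> c" using m u0 by simp
  then have N0: "N > 0" by (simp add: N_def diff_le_mono)
  have "c * (h * u) = c * (k + R)" using assms(1,5) m r by (simp add: algebra_simps)
  then have "h * u = (k - r) + (c + 1) * R" using c0 R r by simp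
  then have "p * (h * u) = p * ((k - r) + (c + 1) * R)" by simp
  then have split: "u * (p * h) = p * (k - r) + (c + 1) * (p * R)"
    by (simp only: distrib_left ac_simps)
  have krc: "real c * (real k - real r) = real (c * (k - r))"
    using R r by (simp add: of_nat_diff)
  have krc0: "c * (k - r) > 0" using R r c0 by simp
  \<comment> \<open>\<open>z\<close> bounds the large parts that one class places in one group over
    its \<open>p\<close> partitions.\<close>
  have "(\<exists>z. p * R \<le> u * z \<and> N * z \<le> b) \<and> p * h \<le> h ^ c + (c + 1) * (p * R div u)"
    using assms(13)
  proof
    assume *: "int p = min p1 p2"
    have "real (p * (c * (k - r))) \<le> real m * (real h ^ c - real c - 1)"
      using * krc0 assms(9) unfolding krc by (intro floor_ge_divide_nat) auto
    then have "real (p * (c * (k - r)) + m * (c + 1)) \<le> real (m * h ^ c)"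
      by (simp add: algebra_simps)
    then have "c * (p * (k - r) + u * (c + 1)) \<le> c * (u * h ^ c)"
      unfolding of_nat_le_iff m by (simp add: algebra_simps)
    then have 1: "p * (k - r) + u * (c + 1) \<le> u * h ^ c" using c0 by simp
    have "\<lfloor>real b / real N\<rfloor> = int (b div N)" by (rule floor_divide_of_nat_eq)
    then have "int p \<le> \<lfloor>real m * real (b div N) / real r\<rfloor>"
      using * assms(10) by (simp add: b_def N_def)
    then have "real (p * r) \<le> real m * real (b div N)"
      using R r c0 by (intro floor_ge_divide_nat) auto
    then have "c * (p * R) \<le> c * (u * (b div N))"
      unfolding m r of_nat_mult[symmetric] of_nat_le_iff by (simp add: ac_simps)
    then have 2: "p * R \<le> u * (b div N)" using c0 by simp
    \<comment> \<open>Rounding \<open>p * R / u\<close> down loses less than 1, hence less than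
      \<open>c + 1\<close> after scaling; the term \<open>- c - 1\<close> in \<open>p1\<close> pays
      for this.\<close>
    have "p * R \<le> u * (p * R div u) + u"
      using mult_div_mod_eq[of u "p * R"] mod_less_divisor[OF u0, of "p * R"] by linarith
    then have "(c + 1) * (p * R) \<le> (c + 1) * (u * (p * R div u) + u)" by (rule mult_le_mono2)
    then have "u * (p * h) \<le> u * (h ^ c + (c + 1) * (p * R div u))"
      using 1 unfolding split by (simp add: algebra_simps)
    then show ?thesis using 2 u0 by (intro conjI exI[of _ "b div N"]) auto
  next
    assume *: "int p = min p1' p2' \<and> m dvd p * r"
    have "real (p * (c * (k - r))) \<le> real m * real h ^ c"
      using * krc0 assms(11) unfolding krc by (intro floor_ge_divide_nat) auto
    then have "real (p * (c * (k - r))) \<le> real (m * h ^ c)" by simp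
    then have "c * (p * (k - r)) \<le> c * (u * h ^ c)"
      unfolding of_nat_le_iff m by (simp add: algebra_simps)
    then have 1: "p * (k - r) \<le> u * h ^ c" using c0 by simp
    \<comment> \<open>Divisibility of \<open>p * r\<close> by \<open>m\<close> makes
      \<open>p * R / u\<close> an integer, so there is no rounding loss in this case.\<close>
    have "c * u dvd c * (p * R)" using * m r by (simp add: ac_simps)
    then have "u dvd p * R" using c0 by simp
    then obtain z where z: "p * R = u * z" by blast
    have "real (p * (r * N)) \<le> real m * real b"
      using * assms(12) N0 R r c0 by (intro floor_ge_divide_nat) (auto simp: N_def b_def)
    then have "m * (N * z) \<le> m * b"
      unfolding m r of_nat_mult[symmetric] of_nat_le_iff using z by (simp add: ac_simps)
    then have 2: "N * z \<le> b" using \<open>m > 0\<close> by simp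
    have "u * (p * h) \<le> u * (h ^ c + (c + 1) * z)"
      using 1 unfolding split z by (simp add: algebra_simps)
    then show ?thesis using 2 z u0 by (intro conjI exI[of _ z]) auto
  qed
  then obtain z where "p * R \<le> u * z" "N * z \<le> b" "p * h \<le> h ^ c + (c + 1) * (p * R div u)" by blast
  then show ?thesis
    using sperner_of_bounds[of n c k R h m u p z] assms(1,2,5) m r R unfolding N_def b_def by simp
qed

end
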